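(* For every real $p$ with $\frac{\sqrt5-1}{\sqrt5+1}<p<1$, all $k\in\mathbb{N}$ and all $\boldsymbol\ell=(\ell_1,\dots,\ell_c)\in\mathbb{N}^c$, writing $\ell=\sum_{i=1}^c\ell_i$, $$R(k,\boldsymbol\ell)\le 4(k+\ell)\left(\frac{1+\sqrt5}{2}p+\frac{1-\sqrt5}{2}\right)^{-k/2}(1-p)^{-\ell}\cdot\Theta(\boldsymbol\ell).$$
   Context: For $k\in\mathbb{N}$ and $\boldsymbol\ell\in\mathbb{N}^c$, the multicolor Ramsey number $R(k,\boldsymbol\ell)$ is the minimum integer $N$ such that every coloring of the edges of the complete graph on $N$ vertices with $c+1$ colors $R,B_1,\dots,B_c$ contains a complete subgraph on $k$ vertices with all edges colored $R$, or, for some $1\le i\le c$, a complete subgraph on $\ell_i$ vertices with all edges colored $B_i$. $\Theta(\boldsymbol\ell)=\frac{\ell^{\ell}}{\ell_1^{\ell_1}\cdots\ell_c^{\ell_c}}$ where $\ell=\sum_i\ell_i$. *)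

theory Defs
  imports Complex_Main "HOL-Library.Ramsey"
begin

text \<open>
  A vector of \<open>c\<close> natural numbers is a \<^typ>\<open>nat list\<close> of length \<open>c\<close>. In
  \<^term>\<open>partn_lst {..<N} (k # ls) 2\<close> the edges of the complete graph on \<open>N\<close> vertices are the
  2-subsets of \<^term>\<open>{..<N}\<close>; colour \<open>0\<close> plays the role of \<open>R\<close> and colour \<open>i\<close>, for
  \<open>1 \<le> i \<le> c\<close>, that of \<open>B\<^sub>i\<close>.
\<close>

definition multicolor_ramsey :: "nat \<Rightarrow> nat list \<Rightarrow> nat" where
  "multicolor_ramsey k ls = (LEAST N. partn_lst {..<N} (k # ls) 2)"

lemma partn_lst_multicolor_ramsey: "partn_lst {..<multicolor_ramsey k ls} (k # ls) 2"
  unfolding multicolor_ramsey_def by (rule LeastI_ex) (rule ramsey_full)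

text \<open>For zero entries the convention is \<open>0\<^sup>0 = 1\<close>.\<close>

definition Theta :: "nat list \<Rightarrow> real" where
  "Theta ls = real (sum_list ls) ^ sum_list ls / (\<Prod>l\<leftarrow>ls. real l ^ l)"

end

theory Submission
  imports Defs "HOL-Analysis.Convex"
begin

text \<open>
  Write \<open>\<phi> = (1 + sqrt 5) / 2\<close>, \<open>x = \<phi> p - 1 / \<phi>\<close> and \<open>w\<^sub>i = \<ell>\<^sub>i / \<ell>\<close>. By induction on \<open>\<ell>\<close>, in a
  colouring without the desired cliques every vertex has \<open>B\<^sub>i\<close>-degree slightly below
  \<open>(1 - p) w\<^sub>i N\<close>, hence red degree slightly above \<open>p N\<close>. For a pair \<open>(X, Y)\<close> consider the excess
  \<open>f(X, Y) = e\<^sub>R(X, Y) - p |X| |Y|\<close>, starting with \<open>X = Y = V\<close>. Some \<open>v \<in> X\<close> with red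
  neighbourhood \<open>Y' \<subseteq> Y\<close>, \<open>|Y'| \<ge> p |Y|\<close>, satisfies \<open>f(X, Y') / |Y'| \<ge> f(X, Y) / |Y|\<close>. Splitting \<open>X\<close> into
  the neighbourhoods of \<open>v\<close>, and since \<open>x + (1 - p) / \<phi> = p\<close>, passing to \<open>Y'\<close> and to one of these
  neighbourhoods multiplies the excess by at least \<open>x\<close> (red) or \<open>w\<^sub>i (1 - p) / \<phi>\<close> (colour \<open>B\<^sub>i\<close>).
  When \<open>X\<close> is used up and \<open>t\<close> red vertices are still needed, \<open>Y\<close> has at least
  \<open>1 / (x^t \<Prod>\<^sub>i (\<phi> (1 - p) w\<^sub>i)^\<ell>\<^sub>i)\<close> vertices; as \<open>x + \<phi> (1 - p) = 1\<close>, this is the Erdos--Szekeres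
  bound, which produces the required clique inside \<open>Y\<close>.
\<close>

section \<open>Colour neighbourhoods and growing a monochromatic clique by one vertex\<close>

text \<open>The vertex \<open>v\<close> is removed because \<open>col {v, v}\<close> is the value at
  a singleton, about which a colouring of edges says nothing.\<close>

definition nbr :: "('a set \<Rightarrow> 'c) \<Rightarrow> 'c \<Rightarrow> 'a \<Rightarrow> 'a set \<Rightarrow> 'a set" where
  "nbr col i v S = {u \<in> S - {v}. col {u, v} = i}"

lemma nbr_subset: "nbr col i v S \<subseteq> S"
  by (auto simp: nbr_def)

lemma finite_nbr [simp]: "finite S \<Longrightarrow> finite (nbr col i v S)"
  by (simp add: nbr_def)

lemma monochromatic_mono:
  "monochromatic S m n col i \<Longrightarrow> S \<subseteq> T \<Longrightarrow> monochromatic T m n col i"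
  unfolding monochromatic_def by (meson nsets_mono subsetD)

lemma monochromatic_0 [simp]: "monochromatic S 0 2 col i"
  by (simp add: monochromatic_def nsets_empty_iff)

lemma monochromatic_1:
  assumes "v \<in> S"
  shows "monochromatic S (Suc 0) 2 col i"
  using assms unfolding monochromatic_def nsets_one
  by (intro bexI[of _ "{v}"]) (auto simp: nsets_singleton_iff)

text \<open>Two sets are needed for the red clique, which may use vertices of both members of a
  pair, while the new vertex is taken from the first.\<close>

lemma monochromatic_extend:
  assumes "monochromatic (nbr col i v S \<union> nbr col i v T) m 2 col i" "v \<in> S"
  shows "monochromatic (S \<union> T) (Suc m) 2 col i"
proof -
  obtain H where H: "H \<subseteq> nbr col i v S \<union> nbr col i v T" "finite H" "card H = m"
    "col ` nsets H 2 \<subseteq> {i}"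
    using assms(1) by (auto simp: monochromatic_def nsets_def)
  have v: "v \<notin> H" and sub: "H \<subseteq> S \<union> T"
    using H(1) by (auto simp: nbr_def)
  have "col e = i" if e: "e \<in> nsets (insert v H) 2" for e
  proof -
    obtain a b where ab: "e = {a, b}" "a \<in> insert v H" "b \<in> insert v H" "a \<noteq> b"
      using nsets2_E[OF e] by metis
    consider "a \<in> H" "b \<in> H" | "a = v" "b \<in> H" | "b = v" "a \<in> H"
      using ab by auto
    then show ?thesis
    proof cases
      case 1
      then have "e \<in> nsets H 2" using ab by simp
      then show ?thesis using H(4) by blast
    next
      case 2
      then show ?thesis using H(1) ab by (auto simp: nbr_def insert_commute)
    next
      case 3
      then show ?thesis using H(1) ab by (auto simp: nbr_def)
    qed
  qed
  moreover have "insert v H \<in> nsets (S \<union> T) (Suc m)"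
    using H v sub assms(2) by (auto simp: nsets_def)
  ultimately show ?thesis unfolding monochromatic_def by blast
qed

lemma monochromatic_extend1:
  "monochromatic (nbr col i v S) m 2 col i \<Longrightarrow> v \<in> S \<Longrightarrow> monochromatic S (Suc m) 2 col i"
  using monochromatic_extend[of col i v S S m] by simp

lemma sum_nbr:
  fixes g :: "'a \<Rightarrow> real"
  assumes "finite J" "finite S" "\<And>u. u \<in> S \<Longrightarrow> u \<noteq> v \<Longrightarrow> col {u, v} \<in> J"
  shows "(\<Sum>j\<in>J. \<Sum>u\<in>nbr col j v S. g u) = (\<Sum>u\<in>S - {v}. g u)"
  unfolding nbr_def using assms by (intro sum.group) auto

section \<open>A weighted Erdos--Szekeres bound\<close>

lemma prod_power_decrement:
  fixes q :: "'c \<Rightarrow> real"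
  assumes "finite J" "j \<in> J" "m j > 0"
  shows "(\<Prod>i\<in>J. q i ^ m i) = q j * (\<Prod>i\<in>J. q i ^ (m(j := m j - 1)) i)"
proof -
  have "(\<Prod>i\<in>J. q i ^ m i) = q j ^ m j * (\<Prod>i\<in>J - {j}. q i ^ m i)"
    using assms by (simp add: prod.remove)
  moreover have "(\<Prod>i\<in>J. q i ^ (m(j := m j - 1)) i) = q j ^ (m j - 1) * (\<Prod>i\<in>J - {j}. q i ^ m i)"
    using assms by (simp add: prod.remove)
  moreover have "q j ^ m j = q j * q j ^ (m j - 1)"
    using assms(3) by (cases "m j") auto
  ultimately show ?thesis by simp
qed

lemma sum_decrement:
  fixes m :: "'c \<Rightarrow> nat"
  assumes "finite J" "j \<in> J" "m j > 0"
  shows "(\<Sum>i\<in>J. (m(j := m j - 1)) i) < (\<Sum>i\<in>J. m i)"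
  using assms by (intro sum_strict_mono_ex1) auto

text \<open>The slack \<open>+ 1\<close> absorbs the vertex lost when passing to a neighbourhood.\<close>

lemma Erdos_Szekeres:
  fixes q :: "'c \<Rightarrow> real"
  assumes J: "finite J" "card J \<ge> 2" and q: "\<And>j. j \<in> J \<Longrightarrow> q j > 0" "sum q J \<le> 1"
    and S: "finite S" "\<And>u v. u \<in> S \<Longrightarrow> v \<in> S \<Longrightarrow> u \<noteq> v \<Longrightarrow> col {u, v} \<in> J"
    and big: "(real (card S) + 1) * (\<Prod>j\<in>J. q j ^ m j) \<ge> 1"
  shows "\<exists>j\<in>J. monochromatic S (m j) 2 col j"
  using S big
proof (induction "\<Sum>j\<in>J. m j" arbitrary: S m rule: less_induct)
  case less
  show ?case
  proof (cases "\<exists>j\<in>J. m j = 0")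
    case True
    then obtain j where "j \<in> J" "m j = 0" by blast
    then show ?thesis using monochromatic_0[of S col j] by metis
  next
    case False
    define Q where "Q = (\<Prod>j\<in>J. q j ^ m j)"
    have Qpos: "Q > 0" unfolding Q_def using q by (intro prod_pos) auto
    \<comment> \<open>A second positive weight keeps each one below 1. As all exponents are positive
      here, the product is then below 1, which excludes an empty \<open>S\<close>.\<close>
    have q1: "q j < 1" if "j \<in> J" for j
    proof -
      have "J - {j} \<noteq> {}" using J that
        by (metis One_nat_def card.empty card_Diff_singleton diff_is_0_eq not_less_eq_eq numeral_2_eq_2)
      then have "sum q (J - {j}) > 0" using J q by (intro sum_pos) auto
      then show ?thesis using q(2) J that by (simp add: sum.remove)
    qed
    have "S \<noteq> {}"
    proof
      assume "S = {}"
      then have "1 \<le> Q" using less.prems(3) by (simp add: Q_def)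
      moreover obtain j where j: "j \<in> J" using J by fastforce
      have "Q = q j * (\<Prod>i\<in>J. q i ^ (m(j := m j - 1)) i)"
        unfolding Q_def using J j False by (intro prod_power_decrement) auto
      moreover have "(\<Prod>i\<in>J. q i ^ (m(j := m j - 1)) i) \<le> 1"
        using q(1) q1 by (intro prod_le_1) (auto intro!: power_le_one simp: less_imp_le)
      ultimately show False using q1[OF j] q(1)[OF j]
        by (smt (verit) mult_left_le)
    qed
    then obtain v where v: "v \<in> S" by blast
    show ?thesis
    proof (rule ccontr)
      assume no: "\<not> ?thesis"
      have small: "(real (card (nbr col j v S)) + 1) * Q < q j" if j: "j \<in> J" for j
      proof (rule ccontr)
        assume "\<not> ?thesis"
        moreover have Q: "Q = q j * (\<Prod>i\<in>J. q i ^ (m(j := m j - 1)) i)"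
          unfolding Q_def using J j False by (intro prod_power_decrement) auto
        ultimately have "q j * 1 \<le> q j * ((real (card (nbr col j v S)) + 1) *
            (\<Prod>i\<in>J. q i ^ (m(j := m j - 1)) i))"
          by (simp add: algebra_simps)
        then have ge: "(real (card (nbr col j v S)) + 1) * (\<Prod>i\<in>J. q i ^ (m(j := m j - 1)) i) \<ge> 1"
          using q(1)[OF j] by (simp only: mult_le_cancel_left_pos)
        have "\<exists>i\<in>J. monochromatic (nbr col j v S) ((m(j := m j - 1)) i) 2 col i"
        proof (rule less.hyps)
          show "(\<Sum>i\<in>J. (m(j := m j - 1)) i) < (\<Sum>i\<in>J. m i)"
            using J j False by (intro sum_decrement) auto
        qed (use ge less.prems nbr_subset[of col j v S] in auto)
        then obtain i where i: "i \<in> J" "monochromatic (nbr col j v S) ((m(j := m j - 1)) i) 2 col i"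
          by blast
        show False
        proof (cases "i = j")
          case True
          then have "monochromatic S (Suc (m j - 1)) 2 col j"
            using i v by (intro monochromatic_extend1) auto
          then show False using no j False by auto
        next
          case False
          then show False using i no nbr_subset monochromatic_mono by (metis fun_upd_other)
        qed
      qed
      have "(\<Sum>j\<in>J. real (card (nbr col j v S))) = real (card (S - {v}))"
        using sum_nbr[of J S v col "\<lambda>_. 1"] J less.prems v by simp
      also have "\<dots> = real (card S) - 1"
        using v card.remove[OF less.prems(1) v] by simp
      finally have deg: "(\<Sum>j\<in>J. real (card (nbr col j v S))) = real (card S) - 1" .
      have "J \<noteq> {}" using J by auto
      then have "(\<Sum>j\<in>J. (real (card (nbr col j v S)) + 1) * Q) < sum q J"
        using J small by (intro sum_strict_mono) auto
      also have "(\<Sum>j\<in>J. (real (card (nbr col j v S)) + 1) * Q) = (real (card S) - 1 + real (card J)) * Q"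
        by (simp add: sum.distrib deg flip: sum_distrib_right)
      finally have "(real (card S) - 1 + real (card J)) * Q < 1" using q(2) by simp
      \<comment> \<open>Each colour class contributes its own slack 1. Two classes suffice to
        restore the removed vertex \<open>v\<close> and the slack of \<open>S\<close>.\<close>
      moreover have "(real (card S) + 1) * Q \<le> (real (card S) - 1 + real (card J)) * Q"
        using J Qpos by (intro mult_right_mono) auto
      ultimately show False using less.prems(3) by (simp add: Q_def)
    qed
  qed
qed

section \<open>Excess of red edges between two sets\<close>

text \<open>The sets may overlap: a red edge inside the intersection counts twice, and a common
  vertex is not its own neighbour but still counts in \<open>card Y\<close>. Writing the excess as a
  sum over \<open>X\<close> makes it additive in \<open>X\<close>.\<close>

definition excess :: "('a set \<Rightarrow> 'c) \<Rightarrow> 'c \<Rightarrow> real \<Rightarrow> 'a set \<Rightarrow> 'a set \<Rightarrow> real" where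
  "excess col r p X Y = (\<Sum>u\<in>X. real (card (nbr col r u Y)) - p * real (card Y))"

lemma nbr_nbr_card:
  assumes "finite Y"
  shows "real (card (nbr col r u (nbr col r v Y)))
    = (\<Sum>y\<in>Y. of_bool (y \<in> nbr col r v Y) * of_bool (y \<in> nbr col r u Y))"
proof -
  have "nbr col r u (nbr col r v Y) = nbr col r v Y \<inter> nbr col r u Y"
    by (auto simp: nbr_def)
  moreover have "Y \<inter> {y \<in> nbr col r v Y. y \<in> nbr col r u Y} = nbr col r v Y \<inter> nbr col r u Y"
    by (auto simp: nbr_def)
  moreover have "of_bool (y \<in> nbr col r v Y) * of_bool (y \<in> nbr col r u Y)
      = (of_bool (y \<in> nbr col r v Y \<and> y \<in> nbr col r u Y) :: real)" for y
    by simp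
  ultimately show ?thesis using assms by (simp only: sum_of_bool_eq)
qed

lemma nbr_card:
  assumes "finite Y"
  shows "real (card (nbr col r u Y)) = (\<Sum>y\<in>Y. of_bool (y \<in> nbr col r u Y))"
proof -
  have "nbr col r u Y = {y \<in> Y. y \<in> nbr col r u Y}"
    by (auto simp: nbr_def)
  then show ?thesis using assms
    by (simp add: sum.If_cases of_bool_def Int_def)
qed

text \<open>Averaging over \<open>v\<close>, this is the Cauchy--Schwarz inequality for the degrees of the vertices
  of \<open>Y\<close> into \<open>X\<close>.\<close>

lemma exists_relative_excess_ge:
  assumes "finite X" "X \<noteq> {}" "finite Y"
  shows "\<exists>v\<in>X. excess col r p X Y * real (card (nbr col r v Y))
    \<le> excess col r p X (nbr col r v Y) * real (card Y)"
proof (rule ccontr)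
  assume "\<not> ?thesis"
  then have less: "excess col r p X (nbr col r v Y) * real (card Y)
      < excess col r p X Y * real (card (nbr col r v Y))" if "v \<in> X" for v
    using that by force
  define R where "R u y = (of_bool (y \<in> nbr col r u Y) :: real)" for u y
  define D where "D y = (\<Sum>u\<in>X. R u y)" for y
  define n where "n = real (card Y)"
  define c where "c = p * real (card X)"
  have card: "real (card (nbr col r u Y)) = (\<Sum>y\<in>Y. R u y)" for u
    unfolding R_def by (rule nbr_card[OF assms(3)])
  have card2: "real (card (nbr col r u (nbr col r v Y))) = (\<Sum>y\<in>Y. R v y * R u y)" for u v
    unfolding R_def by (rule nbr_nbr_card[OF assms(3)])
  have degs: "(\<Sum>v\<in>X. \<Sum>y\<in>Y. R v y) = sum D Y"
    unfolding D_def by (rule sum.swap)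
  have exc: "excess col r p X Y = sum D Y - c * n"
    by (simp add: excess_def card sum_subtractf degs c_def n_def)
  have "excess col r p X (nbr col r v Y) = (\<Sum>y\<in>Y. R v y * D y) - c * (\<Sum>y\<in>Y. R v y)" for v
  proof -
    have "(\<Sum>u\<in>X. \<Sum>y\<in>Y. R v y * R u y) = (\<Sum>y\<in>Y. R v y * D y)"
      unfolding D_def sum_distrib_left by (rule sum.swap)
    then show ?thesis by (simp add: excess_def card card2 sum_subtractf c_def)
  qed
  moreover have "(\<Sum>v\<in>X. \<Sum>y\<in>Y. R v y * D y) = (\<Sum>y\<in>Y. D y * D y)"
    by (subst sum.swap) (simp add: D_def sum_distrib_right)
  ultimately have "(\<Sum>v\<in>X. excess col r p X (nbr col r v Y)) = (\<Sum>y\<in>Y. D y * D y) - c * sum D Y"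
    by (simp add: sum_subtractf degs flip: sum_distrib_left)
  moreover have "(\<Sum>v\<in>X. excess col r p X (nbr col r v Y) * n)
      < (\<Sum>v\<in>X. excess col r p X Y * real (card (nbr col r v Y)))"
    using assms less by (intro sum_strict_mono) (auto simp: n_def)
  ultimately have "((\<Sum>y\<in>Y. D y * D y) - c * sum D Y) * n < (sum D Y - c * n) * sum D Y"
    by (simp add: exc card degs flip: sum_distrib_right sum_distrib_left)
  \<comment> \<open>The terms with \<open>c\<close> cancel, and what remains contradicts
    Cauchy--Schwarz for \<open>D\<close>.\<close>
  then have "(\<Sum>y\<in>Y. D y * D y) * n < (sum D Y)\<^sup>2"
    by (simp add: algebra_simps power2_eq_square)
  moreover have "(sum D Y)\<^sup>2 \<le> (\<Sum>y\<in>Y. D y * D y) * n"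
    using sum_squared_le_sum_of_squares[of D Y] by (simp add: n_def power2_eq_square)
  ultimately show False by simp
qed

text \<open>The discarded vertices contribute negative terms. Afterwards any choice of
  \<open>v\<close> has a red neighbourhood containing at least a proportion \<open>p\<close> of
  \<open>Y\<close>.\<close>

lemma excess_prune:
  assumes "finite X"
  shows "excess col r p X Y
    \<le> excess col r p {u \<in> X. p * real (card Y) \<le> real (card (nbr col r u Y))} Y"
proof -
  let ?g = "\<lambda>u. real (card (nbr col r u Y)) - p * real (card Y)"
  let ?P = "{u \<in> X. p * real (card Y) \<le> real (card (nbr col r u Y))}"
  have "sum ?g X = sum ?g ?P + sum ?g (X - ?P)"
    using assms by (metis (no_types, lifting) add.commute mem_Collect_eq subsetI sum.subset_diff)
  moreover have "sum ?g (X - ?P) \<le> 0"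
    by (intro sum_nonpos) auto
  ultimately show ?thesis by (simp add: excess_def)
qed

text \<open>The vertices other than \<open>v\<close> are grouped by the colour of their edge to
  \<open>v\<close>. The last term is the contribution of \<open>v\<close> itself, which is joined in
  red to its whole red neighbourhood.\<close>

lemma excess_split:
  assumes "finite J" "finite X" "v \<in> X" "\<And>u. u \<in> X \<Longrightarrow> u \<noteq> v \<Longrightarrow> col {u, v} \<in> J"
  shows "excess col r p X (nbr col r v Y)
    = (\<Sum>j\<in>J. excess col r p (nbr col j v X) (nbr col r v Y))
      + (1 - p) * real (card (nbr col r v Y))"
proof -
  have "nbr col r v (nbr col r v Y) = nbr col r v Y"
    by (auto simp: nbr_def)
  then show ?thesis
    using assms unfolding excess_def
    by (subst sum_nbr) (auto simp: sum.remove algebra_simps)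
qed

section \<open>The induction on pairs of sets\<close>

text \<open>A factor \<open>x\<close> is spent when \<open>v\<close> joins the red clique and a
  factor \<open>\<gamma> i\<close> when it joins a blue clique inside \<open>X\<close>; the factors
  \<open>\<beta> i\<close> are reserved for Erdos--Szekeres inside \<open>Y\<close>. Replacing
  \<open>Y\<close> by the red neighbourhood of \<open>v\<close> keeps at least a proportion
  \<open>p\<close> of the excess, so \<open>x + sum \<gamma> I \<le> p\<close> lets some
  neighbourhood retain its share. The exponent \<open>m i\<close> belongs to clique size
  \<open>m i + 1\<close> because a nonempty \<open>X\<close> already supplies one vertex.\<close>

lemma bipartite_clique_induction:
  fixes col :: "'a set \<Rightarrow> 'c"
  assumes I: "finite I" "I \<noteq> {}" "r \<notin> I"
    and p: "0 < p" "p < 1" and x: "0 < x"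
    and g: "\<And>i. i \<in> I \<Longrightarrow> \<gamma> i > 0" "x + sum \<gamma> I \<le> p"
    and b: "\<And>i. i \<in> I \<Longrightarrow> \<beta> i > 0" "x + sum \<beta> I \<le> 1"
    and "finite X" "finite Y"
    and "\<And>u v. u \<in> X \<union> Y \<Longrightarrow> v \<in> X \<union> Y \<Longrightarrow> u \<noteq> v \<Longrightarrow> col {u, v} \<in> insert r I"
    and "(excess col r p X Y + (1 - p) * real (card Y))
      * (x ^ k * (\<Prod>i\<in>I. \<gamma> i ^ m i) * (\<Prod>i\<in>I. \<beta> i ^ l i)) \<ge> 1"
  shows "monochromatic (X \<union> Y) k 2 col r
    \<or> (\<exists>i\<in>I. monochromatic X (Suc (m i)) 2 col i \<or> monochromatic Y (l i) 2 col i)"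
  using assms(11-)
proof (induction "k + (\<Sum>i\<in>I. m i)" arbitrary: X Y k m rule: less_induct)
  case less
  note finX = less.prems(1) and finY = less.prems(2) and cols = less.prems(3)
  define B where "B = (\<Prod>i\<in>I. \<beta> i ^ l i)"
  define G where "G = (\<Prod>i\<in>I. \<gamma> i ^ m i)"
  have Bpos: "B > 0" unfolding B_def using b by (intro prod_pos) auto
  have Gpos: "G > 0" unfolding G_def using g by (intro prod_pos) auto
  have xk: "x ^ k > 0" using x by simp
  have big: "(excess col r p X Y + (1 - p) * real (card Y)) * (x ^ k * G * B) \<ge> 1"
    using less.prems(4) by (simp add: B_def G_def)
  have "sum \<gamma> I > 0" using I g by (intro sum_pos) auto
  then have "\<gamma> i \<le> 1" if "i \<in> I" for i
    using that g p x I member_le_sum[of i I \<gamma>] by fastforce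
  then have G1: "G \<le> 1" unfolding G_def
    using g by (intro prod_le_1) (auto intro!: power_le_one simp: less_imp_le)
  show ?case
  proof (cases "k = 0 \<or> real (card Y) * (x ^ k * B) \<ge> 1")
    case True
    show ?thesis
    proof (cases "k = 0")
      case True
      then show ?thesis by simp
    next
      case False
      with True have big: "real (card Y) * (x ^ k * B) \<ge> 1" by simp
      \<comment> \<open>\<open>Y\<close> is already large enough: Erdos--Szekeres applies with
        weight \<open>x\<close> for red and \<open>\<beta> i\<close> for blue.\<close>
      define q where "q = \<beta>(r := x)"
      have qI: "q i = \<beta> i" "(l(r := k)) i = l i" if "i \<in> I" for i
        using that I by (auto simp: q_def)
      have "(\<Prod>j\<in>insert r I. q j ^ (l(r := k)) j) = x ^ k * B"
        using I qI by (simp add: B_def q_def cong: prod.cong)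
      moreover have "sum q (insert r I) = x + sum \<beta> I"
        using I qI by (simp add: q_def cong: sum.cong)
      moreover have big': "(real (card Y) + 1) * (x ^ k * B) \<ge> 1"
        using big xk Bpos by (simp add: distrib_right add_increasing2)
      moreover have "card (insert r I) \<ge> 2"
        using I by (simp add: Suc_le_eq card_gt_0_iff)
      ultimately have "\<exists>j\<in>insert r I. monochromatic Y ((l(r := k)) j) 2 col j"
        using I b x finY cols big' by (intro Erdos_Szekeres[where q = q]) (auto simp: q_def)
      then show ?thesis using qI monochromatic_mono[of Y _ 2 col _ "X \<union> Y"] by auto
    qed
  next
    case False
    then have k: "k > 0" and small: "real (card Y) * (x ^ k * B) < 1" by auto
    define E where "E = excess col r p X Y"
    have Ypos: "card Y > 0"
    proof (rule ccontr)
      assume "\<not> ?thesis"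
      then have "Y = {}" using finY by auto
      then have "E = 0" by (simp add: E_def excess_def nbr_def)
      then show False using big \<open>Y = {}\<close> by (simp add: E_def)
    qed
    define X' where "X' = {u \<in> X. p * real (card Y) \<le> real (card (nbr col r u Y))}"
    define E' where "E' = excess col r p X' Y"
    have EE: "E \<le> E'" unfolding E_def E'_def X'_def by (rule excess_prune[OF finX])
    \<comment> \<open>Since \<open>G \<le> 1\<close> and \<open>Y\<close> is small, the term
      \<open>(1 - p) * card Y\<close> alone cannot reach the required bound; the excess must exceed
      \<open>p * card Y\<close>. Hence pruning leaves a vertex.\<close>
    have "E > 0"
    proof -
      have "real (card Y) * (x ^ k * B) * G \<le> real (card Y) * (x ^ k * B)"
        using G1 Bpos xk by (intro mult_left_le) auto
      with small have "real (card Y) * (x ^ k * G * B) < 1" by (simp add: mult_ac)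
      then have "real (card Y) * (x ^ k * G * B)
          < (E + (1 - p) * real (card Y)) * (x ^ k * G * B)"
        using big by (simp add: E_def)
      then have "real (card Y) < E + (1 - p) * real (card Y)"
        using xk Gpos Bpos by (simp only: mult_less_cancel_right_pos mult_pos_pos)
      then have "p * real (card Y) < E" by (simp add: algebra_simps)
      then show ?thesis using p by (smt (verit) mult_nonneg_nonneg of_nat_0_le_iff)
    qed
    have X'ne: "X' \<noteq> {}" using \<open>E > 0\<close> EE by (auto simp: E'_def excess_def)
    have X'sub: "X' \<subseteq> X" and finX': "finite X'" using finX by (auto simp: X'_def)
    show ?thesis
    proof (cases "\<exists>i\<in>I. m i = 0")
      case True
      then obtain i where "i \<in> I" "m i = 0" by blast
      moreover have "monochromatic X (Suc 0) 2 col i"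
        using X'ne X'sub by (auto intro: monochromatic_1)
      ultimately show ?thesis by metis
    next
      case mpos: False
      obtain v where v: "v \<in> X'"
        "E' * real (card (nbr col r v Y)) \<le> excess col r p X' (nbr col r v Y) * real (card Y)"
        using exists_relative_excess_ge[OF finX' X'ne finY, of col r p] by (auto simp: E'_def)
      define Z where "Z = nbr col r v Y"
      have finZ: "finite Z" and ZY: "Z \<subseteq> Y"
        using finY by (simp_all add: Z_def nbr_subset)
      have Zbig: "p * real (card Y) \<le> real (card Z)" using v by (simp add: X'_def Z_def)
      have Zpos: "real (card Z) > 0" using Zbig Ypos p by (smt (verit) mult_pos_pos of_nat_0_less_iff)
      define T where "T = x ^ k * G * B"
      have Tpos: "T > 0" using xk Gpos Bpos by (simp add: T_def)
      define Ex where "Ex j = excess col r p (nbr col j v X') Z" for j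
      have cols': "col {u, w} \<in> insert r I" if "u \<in> nbr col j v X' \<union> Z" "w \<in> nbr col j v X' \<union> Z" "u \<noteq> w"
        for u w j
        using that ZY X'sub nbr_subset[of col j v X'] by (intro cols) auto
      show ?thesis
      proof (rule ccontr)
        assume no: "\<not> ?thesis"
        \<comment> \<open>If the red neighbourhood kept its share, the induction hypothesis with
          \<open>k - 1\<close> would give a forbidden clique. The same is done below for each blue
          colour with \<open>m i - 1\<close>.\<close>
        have red: "(Ex r + (1 - p) * card Z) * T < x"
        proof (rule ccontr)
          assume "\<not> ?thesis"
          moreover have "T = x * (x ^ (k - 1) * G * B)"
            using k by (cases k) (auto simp: T_def)
          ultimately have "x * 1 \<le> x * ((Ex r + (1 - p) * card Z) * (x ^ (k - 1) * G * B))"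
            by (simp add: mult_ac)
          then have "1 \<le> (Ex r + (1 - p) * card Z) * (x ^ (k - 1) * G * B)"
            using x by (simp only: mult_le_cancel_left_pos)
          then have "monochromatic (nbr col r v X' \<union> Z) (k - 1) 2 col r
            \<or> (\<exists>i\<in>I. monochromatic (nbr col r v X') (Suc (m i)) 2 col i \<or> monochromatic Z (l i) 2 col i)"
            using k finX' finZ cols'
            by (intro less.hyps) (auto simp: Ex_def G_def B_def)
          then show False
          proof (elim disjE bexE)
            assume "monochromatic (nbr col r v X' \<union> Z) (k - 1) 2 col r"
            then have "monochromatic (X' \<union> Y) (Suc (k - 1)) 2 col r"
              using v unfolding Z_def by (intro monochromatic_extend) auto
            then have "monochromatic (X \<union> Y) k 2 col r"
              using k X'sub by (auto elim!: monochromatic_mono)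
            then show False using no by blast
          qed (use no X'sub ZY nbr_subset monochromatic_mono subset_trans in metis)+
        qed
        have blue: "(Ex i + (1 - p) * card Z) * T < \<gamma> i" if i: "i \<in> I" for i
        proof (rule ccontr)
          let ?m = "m(i := m i - 1)"
          assume "\<not> ?thesis"
          moreover have "T = \<gamma> i * (x ^ k * (\<Prod>j\<in>I. \<gamma> j ^ ?m j) * B)"
            using prod_power_decrement[of I i m \<gamma>] I i mpos by (simp add: T_def G_def)
          ultimately have "\<gamma> i * 1 \<le> \<gamma> i * ((Ex i + (1 - p) * card Z) * (x ^ k * (\<Prod>j\<in>I. \<gamma> j ^ ?m j) * B))"
            by (simp add: mult_ac)
          then have "1 \<le> (Ex i + (1 - p) * card Z) * (x ^ k * (\<Prod>j\<in>I. \<gamma> j ^ ?m j) * B)"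
            using g(1)[OF i] by (simp only: mult_le_cancel_left_pos)
          moreover have "(\<Sum>j\<in>I. ?m j) < (\<Sum>j\<in>I. m j)"
            using I i mpos by (intro sum_decrement) auto
          ultimately have "monochromatic (nbr col i v X' \<union> Z) k 2 col r
            \<or> (\<exists>j\<in>I. monochromatic (nbr col i v X') (Suc (?m j)) 2 col j \<or> monochromatic Z (l j) 2 col j)"
            using finX' finZ cols'
            by (intro less.hyps) (auto simp: Ex_def B_def)
          then show False
          proof (elim disjE bexE)
            assume "monochromatic (nbr col i v X' \<union> Z) k 2 col r"
            moreover have "nbr col i v X' \<union> Z \<subseteq> X \<union> Y"
              using X'sub ZY nbr_subset[of col i v X'] by auto
            ultimately show False using no monochromatic_mono by metis
          next
            fix j assume j: "j \<in> I" "monochromatic (nbr col i v X') (Suc (?m j)) 2 col j"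
            show False
            proof (cases "j = i")
              case True
              then have "monochromatic (nbr col i v X') (m i) 2 col i"
                using j i mpos by simp
              then have "monochromatic X' (Suc (m i)) 2 col i"
                using v by (intro monochromatic_extend1) auto
              then show False using no i X'sub monochromatic_mono by metis
            next
              case False
              then show False
                using j no X'sub nbr_subset monochromatic_mono by (metis fun_upd_other)
            qed
          qed (use no ZY monochromatic_mono in metis)
        qed
        have "(\<Sum>i\<in>I. (Ex i + (1 - p) * card Z) * T) < sum \<gamma> I"
          using I blue by (intro sum_strict_mono) auto
        then have "((\<Sum>i\<in>I. Ex i) + real (card I) * ((1 - p) * card Z)) * T < sum \<gamma> I"
          by (simp add: sum.distrib flip: sum_distrib_right)
        with red g(2) have "(Ex r + (\<Sum>i\<in>I. Ex i) + (1 + real (card I)) * ((1 - p) * card Z)) * T < p"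
          by (simp add: algebra_simps)
        \<comment> \<open>There are at least two colours, hence two copies of the slack: one pays
          for \<open>v\<close> in \<open>excess_split\<close>, the other is the slack of the pair
          \<open>(X', Z)\<close>.\<close>
        moreover have "(2 * ((1 - p) * card Z)) * T \<le> ((1 + real (card I)) * ((1 - p) * card Z)) * T"
          using I p Tpos by (intro mult_right_mono) (auto simp: Suc_le_eq card_gt_0_iff)
        ultimately have "(Ex r + (\<Sum>i\<in>I. Ex i) + (1 - p) * card Z + (1 - p) * card Z) * T < p"
          by (simp add: algebra_simps)
        moreover have "excess col r p X' Z = Ex r + (\<Sum>i\<in>I. Ex i) + (1 - p) * card Z"
          using excess_split[of "insert r I" X' v col r p Y] I finX' v X'sub cols
          by (auto simp: Ex_def Z_def)
        ultimately have up: "(excess col r p X' Z + (1 - p) * card Z) * T < p"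
          by simp
        \<comment> \<open>Multiplying by \<open>card Z\<close> and using the choice of
          \<open>v\<close> compares \<open>card Z\<close> with the upper bound just found, forcing
          \<open>card Z < p * card Y\<close>.\<close>
        have "1 \<le> (E' + (1 - p) * card Y) * T"
          using big EE Tpos unfolding T_def[symmetric] E_def[symmetric]
          by (smt (verit) mult_right_mono)
        then have "real (card Z) * 1 \<le> real (card Z) * ((E' + (1 - p) * card Y) * T)"
          by (intro mult_left_mono) auto
        also have "\<dots> = (E' * card Z + (1 - p) * card Z * card Y) * T"
          by (simp add: algebra_simps)
        also have "\<dots> \<le> (excess col r p X' Z * card Y + (1 - p) * card Z * card Y) * T"
          using v Tpos by (intro mult_right_mono add_right_mono) (auto simp: Z_def)
        also have "\<dots> = ((excess col r p X' Z + (1 - p) * card Z) * T) * card Y"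
          by (simp add: algebra_simps)
        also have "\<dots> < p * card Y"
          using up Ypos by (intro mult_strict_right_mono) auto
        finally show False using Zbig by simp
      qed
    qed
  qed
qed

section \<open>Ramsey numbers and colourings of arbitrary finite sets\<close>

lemma multicolor_ramsey_le:
  "partn_lst {..<n} (k # ls) 2 \<Longrightarrow> multicolor_ramsey k ls \<le> n"
  unfolding multicolor_ramsey_def by (rule Least_le)

text \<open>Neighbourhoods are not initial segments, so the colouring is pulled back along a
  bijection from an initial segment onto a subset of \<open>S\<close>.\<close>

lemma monochromatic_if_multicolor_ramsey_le_card:
  fixes S :: "'a set"
  assumes S: "finite S" "multicolor_ramsey k ls \<le> card S"
    and col: "col \<in> nsets S 2 \<rightarrow> {..<Suc (length ls)}"
  shows "\<exists>j<Suc (length ls). monochromatic S ((k # ls) ! j) 2 col j"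
proof -
  let ?N = "multicolor_ramsey k ls"
  obtain S' where S': "S' \<subseteq> S" "card S' = ?N"
    using obtain_subset_with_card_n[OF S(2)] by metis
  then have "finite S'" using S by (auto intro: finite_subset)
  then obtain h where h: "bij_betw h {..<?N} S'"
    using ex_bij_betw_nat_finite[of S'] S' by (auto simp: atLeast0LessThan)
  have inj: "inj_on h {..<?N}" and im: "h ` {..<?N} \<subseteq> S"
    using h S' by (auto simp: bij_betw_def)
  have "(\<lambda>e. col (h ` e)) \<in> nsets {..<?N} 2 \<rightarrow> {..<length (k # ls)}"
    using nsets_image_funcset[of h "{..<?N}" S 2] inj im col by (auto simp: Pi_iff image_subset_iff)
  then obtain j H where j: "j < length (k # ls)" and H: "H \<in> nsets {..<?N} ((k # ls) ! j)"
    and mono: "(\<lambda>e. col (h ` e)) ` nsets H 2 \<subseteq> {j}"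
    using partn_lstE[OF partn_lst_multicolor_ramsey] by (metis (no_types, lifting))
  have injH: "inj_on h H" using H inj by (auto simp: nsets_def intro: inj_on_subset)
  have hH: "h ` H \<in> nsets S ((k # ls) ! j)"
    using H im card_image[OF injH] by (auto simp: nsets_def)
  have "col e = j" if e: "e \<in> nsets (h ` H) 2" for e
  proof -
    obtain a b where "e = {a, b}" "a \<in> h ` H" "b \<in> h ` H" "a \<noteq> b"
      using nsets2_E[OF e] by metis
    then obtain a' b' where "e = h ` {a', b'}" "{a', b'} \<in> nsets H 2" by auto
    then show ?thesis using mono by blast
  qed
  then show ?thesis using j hH by (auto simp: monochromatic_def)
qed

text \<open>A clique of size \<open>ls ! i - 1\<close> in the neighbourhood would be completed by
  \<open>v\<close>. This turns the induction hypothesis of the theorem into a bound on blue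
  degrees.\<close>

lemma card_nbr_less_multicolor_ramsey:
  assumes "finite S" "col \<in> nsets S 2 \<rightarrow> {..<Suc (length ls)}"
    and no: "\<And>j. j < Suc (length ls) \<Longrightarrow> \<not> monochromatic S ((k # ls) ! j) 2 col j"
    and i: "i < length ls" and v: "v \<in> S"
  shows "card (nbr col (Suc i) v S) < multicolor_ramsey k (ls[i := ls ! i - 1])"
proof (rule ccontr)
  let ?T = "nbr col (Suc i) v S" and ?ls = "ls[i := ls ! i - 1]"
  assume "\<not> ?thesis"
  moreover have "col \<in> nsets ?T 2 \<rightarrow> {..<Suc (length ?ls)}"
    using assms(2) nsets_mono[OF nbr_subset[of col "Suc i" v S], of 2] by auto
  ultimately obtain j where j: "j < Suc (length ls)" "monochromatic ?T ((k # ?ls) ! j) 2 col j"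
    using monochromatic_if_multicolor_ramsey_le_card[of ?T k ?ls col] assms(1) by auto
  show False
  proof (cases "j = Suc i")
    case True
    \<comment> \<open>The empty clique always exists, so the truncated subtraction is a true
      one.\<close>
    have "ls ! i > 0" using no[of "Suc i"] i by (intro gr0I) auto
    then have "monochromatic S (ls ! i) 2 col j"
      using monochromatic_extend1[of col j v S "ls ! i - 1"] j v i True by auto
    then show False using no[of j] True i by simp
  next
    case False
    then have "(k # ?ls) ! j = (k # ls) ! j" by (cases j) auto
    then show False using j no[of j] monochromatic_mono[OF _ nbr_subset] by metis
  qed
qed

section \<open>Properties of \<open>Theta\<close>\<close>

lemma Theta_altdef:
  "Theta ls = real (sum_list ls) ^ sum_list ls / (\<Prod>i<length ls. real (ls ! i) ^ (ls ! i))"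
  by (simp add: Theta_def prod.list_conv_set_nth atLeast0LessThan)

lemma Theta_nonneg: "Theta ls \<ge> 0"
  by (auto simp: Theta_altdef intro!: divide_nonneg_nonneg prod_nonneg)

lemma sum_list_power_prod_nth:
  fixes a :: real
  shows "(\<Prod>i<length ls. a ^ (ls ! i)) = a ^ sum_list ls"
  by (simp add: sum_list_sum_nth atLeast0LessThan power_sum)

text \<open>Distributing \<open>l ^ l\<close> over the entries shows \<open>Theta\<close> to be the
  inverse of the product of the powers of the weights \<open>l_i / l\<close>.\<close>

lemma Theta_weights:
  assumes "sum_list ls > 0"
  shows "Theta ls * (\<Prod>i<length ls. (real (ls ! i) / real (sum_list ls)) ^ (ls ! i)) = 1"
proof -
  define s where "s = sum_list ls"
  define P where "P = (\<Prod>i<length ls. real (ls ! i) ^ (ls ! i))"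
  have "P \<noteq> 0" by (auto simp: P_def)
  moreover have "real s ^ s \<noteq> 0"
    using assms by (simp flip: s_def)
  moreover have "(\<Prod>i<length ls. (real (ls ! i) / real s) ^ (ls ! i)) = P / real s ^ s"
    by (simp add: power_divide prod_dividef P_def sum_list_power_prod_nth s_def)
  ultimately show ?thesis
    by (simp add: Theta_altdef flip: s_def P_def)
qed

text \<open>The quotient of the two bases is \<open>1 - 1 / n^2\<close>, and Bernoulli bounds its
  power \<open>n - 1\<close> below by \<open>n / (n + 1)\<close>. For \<open>n = 1\<close> the right
  side is \<open>0 ^ 0 = 1\<close>.\<close>

lemma power_pred_ratio_Suc:
  assumes "n \<ge> 1"
  shows "(real n / (real n + 1)) ^ n \<le> ((real n - 1) / real n) ^ (n - 1)"
proof -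
  have n: "real n > 0" using assms by simp
  define c where "c = 1 + - (1 / (real n)\<^sup>2)"
  have n2: "1 / (real n)\<^sup>2 \<le> 1" using n assms by simp
  have "real n / (real n + 1) \<le> 1 + real (n - 1) * - (1 / (real n)\<^sup>2)"
    using n assms by (simp add: field_simps of_nat_diff power2_eq_square)
  also have "\<dots> \<le> c ^ (n - 1)"
    unfolding c_def using n2 by (intro Bernoulli_inequality) auto
  finally have "real n / (real n + 1) * (real n / (real n + 1)) ^ (n - 1)
      \<le> c ^ (n - 1) * (real n / (real n + 1)) ^ (n - 1)"
    using n by (intro mult_right_mono) auto
  also have "\<dots> = (c * (real n / (real n + 1))) ^ (n - 1)"
    by (rule power_mult_distrib[symmetric])
  also have "c * (real n / (real n + 1)) = (real n - 1) / real n"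
  proof -
    have "c = ((real n - 1) / real n) * ((real n + 1) / real n)"
      using n by (simp add: c_def field_simps power2_eq_square)
    then show ?thesis using n by simp
  qed
  finally show ?thesis using assms by (simp flip: power_Suc)
qed

lemma power_pred_ratio_antimono:
  assumes "1 \<le> a" "a \<le> (b::nat)"
  shows "((real b - 1) / real b) ^ (b - 1) \<le> ((real a - 1) / real a) ^ (a - 1)"
  using assms(2)
proof (induction b rule: dec_induct)
  case base
  then show ?case by simp
next
  case (step n)
  then show ?case using power_pred_ratio_Suc[of n] assms(1) by (simp add: add.commute)
qed

text \<open>After cancellation this is \<open>power_pred_ratio_antimono\<close> for
  \<open>ls ! i \<le> sum_list ls\<close>. The factors on the right sum to 1 over \<open>i\<close>,
  so the blue degree bounds add up without loss.\<close>

lemma Theta_decrement: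
  assumes i: "i < length ls" and pos: "ls ! i > 0"
  shows "Theta (ls[i := ls ! i - 1]) \<le> real (ls ! i) / real (sum_list ls) * Theta ls"
proof -
  define a where "a = ls ! i"
  define b where "b = sum_list ls"
  define P where "P = (\<Prod>j\<in>{..<length ls} - {i}. real (ls ! j) ^ (ls ! j))"
  have ab: "1 \<le> a" "a \<le> b"
    using pos i by (auto simp: a_def b_def intro: member_le_sum_list)
  have P: "P > 0" unfolding P_def by (intro prod_pos) (auto simp: zero_less_power_eq)
  have "sum_list (ls[i := a - 1]) = b - 1"
    using i pos ab by (simp add: sum_list_update a_def b_def)
  moreover have "(\<Prod>j<length ls. real (ls[i := a - 1] ! j) ^ (ls[i := a - 1] ! j))
      = real (a - 1) ^ (a - 1) * P"
    using i by (simp add: P_def prod.remove[of _ i])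
  ultimately have T': "Theta (ls[i := a - 1]) = real (b - 1) ^ (b - 1) / (real (a - 1) ^ (a - 1) * P)"
    by (simp add: Theta_altdef)
  have "(\<Prod>j<length ls. real (ls ! j) ^ (ls ! j)) = real a ^ a * P"
    using i by (simp add: P_def a_def prod.remove[of _ i])
  then have "Theta ls = real b ^ b / (real a ^ a * P)"
    by (simp add: Theta_altdef b_def)
  then have T: "real a / real b * Theta ls = real b ^ (b - 1) / (real a ^ (a - 1) * P)"
    using ab P power_minus_mult[of a "real a"] power_minus_mult[of b "real b"]
    by (simp add: divide_simps) (simp add: mult_ac)
  have pos': "real (a - 1) ^ (a - 1) > 0" "real a ^ (a - 1) > 0" "real b ^ (b - 1) > 0"
    using ab by (auto simp: zero_less_power_eq)
  have "(real (b - 1) / real b) ^ (b - 1) \<le> (real (a - 1) / real a) ^ (a - 1)"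
    using power_pred_ratio_antimono[OF ab] ab by (simp add: of_nat_diff)
  then have "real (b - 1) ^ (b - 1) / real (a - 1) ^ (a - 1) \<le> real b ^ (b - 1) / real a ^ (a - 1)"
    using pos' unfolding power_divide by (simp add: divide_simps mult.commute)
  then have "real (b - 1) ^ (b - 1) / real (a - 1) ^ (a - 1) / P \<le> real b ^ (b - 1) / real a ^ (a - 1) / P"
    using P by (intro divide_right_mono) auto
  then show ?thesis using T T' by (simp add: a_def b_def)
qed

text \<open>Each product contains the weights once, so together they cancel \<open>Theta\<close>
  squared. The case needed is \<open>d = 1 - p\<close>, where the golden ratio and its inverse
  multiply to 1.\<close>

lemma prod_weight_powers:
  fixes a c :: real
  assumes "sum_list ls > 0" "a * c = d\<^sup>2"
  shows "(\<Prod>i<length ls. (a * (real (ls ! i) / real (sum_list ls))) ^ (ls ! i))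
      * (\<Prod>i<length ls. (c * (real (ls ! i) / real (sum_list ls))) ^ (ls ! i)) * (Theta ls)\<^sup>2
    = (d ^ sum_list ls)\<^sup>2"
proof -
  let ?W = "\<Prod>i<length ls. (real (ls ! i) / real (sum_list ls)) ^ (ls ! i)"
  have pull: "(\<Prod>i<length ls. (t * (real (ls ! i) / real (sum_list ls))) ^ (ls ! i))
      = t ^ sum_list ls * ?W" for t :: real
    by (simp only: power_mult_distrib prod.distrib sum_list_power_prod_nth)
  have "a ^ sum_list ls * ?W * (c ^ sum_list ls * ?W) * (Theta ls)\<^sup>2
      = (a * c) ^ sum_list ls * (Theta ls * ?W)\<^sup>2"
    by (simp only: power_mult_distrib power2_eq_square mult_ac)
  also have "\<dots> = (d ^ sum_list ls)\<^sup>2"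
    by (simp only: Theta_weights[OF assms(1)] assms(2)) (simp flip: power_mult add: mult.commute)
  finally show ?thesis by (simp only: pull)
qed

lemma Theta_ge_1:
  assumes "sum_list ls > 0"
  shows "Theta ls \<ge> 1"
proof -
  let ?W = "\<Prod>i<length ls. (real (ls ! i) / real (sum_list ls)) ^ (ls ! i)"
  have "?W \<le> 1"
  proof (intro prod_le_1 conjI power_le_one)
    fix i assume "i \<in> {..<length ls}"
    then have "ls ! i \<le> sum_list ls" by (auto intro: member_le_sum_list)
    then show "real (ls ! i) / real (sum_list ls) \<le> 1"
      by (intro divide_le_eq_1[THEN iffD2]) auto
  qed auto
  then have "Theta ls * ?W \<le> Theta ls" using Theta_nonneg by (intro mult_left_le) auto
  then show ?thesis by (simp only: Theta_weights[OF assms])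
qed

section \<open>From small blue degrees to a clique\<close>

text \<open>The pair induction starts at \<open>X = Y = V\<close>. Small blue degrees give every
  vertex a red surplus of order \<open>M\<close>, hence a total excess of order \<open>M\<close>
  times \<open>card V\<close>, thus at least of order \<open>M\<close> squared; this explains the
  square root in the exponent of \<open>x\<close>.\<close>

lemma monochromatic_if_blue_degrees_small:
  fixes p x :: real and ls :: "nat list" and V :: "'a set"
  defines "l \<equiv> sum_list ls"
  assumes p: "0 < p" "p < 1" and x: "x = (1 + sqrt 5) / 2 * p + (1 - sqrt 5) / 2" "0 < x" "x < 1"
    and k: "k > 0" and ls: "ls \<noteq> []" "0 \<notin> set ls"
    and V: "finite V" and col: "col \<in> nsets V 2 \<rightarrow> {..<Suc (length ls)}"
    and M: "M = x powr (- (real k / 2)) * (1 - p) powr (- real l) * Theta ls"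
    and card_V: "4 * (real k + real l) * M - 1 \<le> real (card V)"
    and deg: "\<And>v. v \<in> V \<Longrightarrow> (\<Sum>i<length ls. real (card (nbr col (Suc i) v V))) + 1
      \<le> (1 - p) * (4 * (real k + real l - 1) * M)"
  shows "\<exists>j<Suc (length ls). monochromatic V ((k # ls) ! j) 2 col j"
proof -
  define \<phi> \<psi> :: real where "\<phi> = (1 + sqrt 5) / 2" and "\<psi> = (sqrt 5 - 1) / 2"
  have phi: "\<phi> = 1 + \<psi>" "\<phi> * \<psi> = 1" "0 < \<psi>" "\<psi> < 1"
    by (auto simp: \<phi>_def \<psi>_def field_simps real_less_lsqrt)
  have xphi: "x = \<phi> * p - \<psi>" by (simp add: x(1) \<phi>_def \<psi>_def field_simps)
  define I where "I = {Suc 0..length ls}"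
  define L where "L j = (k # ls) ! j" for j
  define w where "w j = real (L j) / real l" for j
  define \<gamma> where "\<gamma> j = \<psi> * (1 - p) * w j" for j
  define \<beta> where "\<beta> j = \<phi> * (1 - p) * w j" for j
  define n where "n = real (card V)"
  have Lpos: "L j > 0" if j: "j \<in> I" for j
  proof -
    obtain i where "j = Suc i" "i < length ls"
      using j by (cases j) (auto simp: I_def)
    then show ?thesis using ls(2) nth_mem[of i ls] by (metis L_def gr0I nth_Cons_Suc)
  qed
  have I: "finite I" "I \<noteq> {}" "0 \<notin> I" using ls(1) by (auto simp: I_def Suc_le_eq)
  have cols: "col {u, w} \<in> insert 0 I" if "u \<in> V" "w \<in> V" "u \<noteq> w" for u w
  proof -
    have "{u, w} \<in> nsets V 2" using that by simp
    then have "col {u, w} < Suc (length ls)" using col by blast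
    then show ?thesis by (cases "col {u, w}") (auto simp: I_def)
  qed
  have Iprod: "prod h I = (\<Prod>i<length ls. h (Suc i))" for h :: "nat \<Rightarrow> real"
    unfolding I_def by (rule prod.atLeast1_atMost_eq)
  have Isum: "sum h I = (\<Sum>i<length ls. h (Suc i))" for h :: "nat \<Rightarrow> real"
    unfolding I_def by (rule sum.atLeast1_atMost_eq)
  have "(\<Sum>j\<in>I. real (L j)) = real l"
    by (simp add: Isum l_def L_def sum_list_sum_nth atLeast0LessThan)
  moreover from this have lpos: "l > 0"
    using I Lpos by (metis of_nat_0_less_iff sum_pos)
  ultimately have wsum: "sum w I = 1"
    by (simp add: w_def flip: sum_divide_distrib)
  have wpos: "w j > 0" if "j \<in> I" for j using Lpos[OF that] lpos by (simp add: w_def)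
  have w1: "w j \<le> 1" if "j \<in> I" for j
    using wsum wpos that I member_le_sum[of j I w] by (auto simp: less_imp_le)
  have gpos: "\<gamma> j > 0" "\<beta> j > 0" if "j \<in> I" for j
    using that wpos phi p by (auto simp: \<gamma>_def \<beta>_def)
  have "sum \<gamma> I = \<psi> * (1 - p)" "sum \<beta> I = \<phi> * (1 - p)"
    using wsum by (simp_all add: \<gamma>_def \<beta>_def flip: sum_distrib_left)
  then have gsum: "x + sum \<gamma> I \<le> p" and bsum: "x + sum \<beta> I \<le> 1"
    using phi by (auto simp: xphi algebra_simps)
  have g1: "\<gamma> j \<le> 1 - p" if "j \<in> I" for j
    using mult_mono[of \<psi> 1 "w j" 1] w1[OF that] wpos[OF that] phi p
    by (simp add: \<gamma>_def mult.assoc mult.left_commute mult_left_le)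
  have M1: "M \<ge> 1"
  proof -
    have "x powr (- (real k / 2)) \<ge> 1" "(1 - p) powr (- real l) \<ge> 1"
      using x p by (auto simp: powr_minus divide_simps powr_le_one_le intro!: powr_le1)
    then show ?thesis unfolding M using Theta_ge_1 lpos
      by (metis l_def mult_mono' mult_1 zero_le_one mult_nonneg_nonneg powr_ge_zero)
  qed
  \<comment> \<open>\<open>M\<close> is exactly the inverse square root of the full product of
    weights.\<close>
  have M2: "M\<^sup>2 * (x ^ k * (\<Prod>j\<in>I. \<gamma> j ^ L j) * (\<Prod>j\<in>I. \<beta> j ^ L j)) = 1"
  proof -
    have X: "(x powr (- (real k / 2)))\<^sup>2 * x ^ k = 1"
      using x by (simp add: powr_minus powr_realpow[symmetric] power2_eq_square powr_add[symmetric]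
          flip: inverse_mult_distrib)
    have P: "((1 - p) powr (- real l))\<^sup>2 * ((1 - p) ^ l)\<^sup>2 = 1"
      using p by (simp add: powr_minus powr_realpow flip: power_mult_distrib)
    have W: "(\<Prod>j\<in>I. \<gamma> j ^ L j) * (\<Prod>j\<in>I. \<beta> j ^ L j) * (Theta ls)\<^sup>2 = ((1 - p) ^ l)\<^sup>2"
      unfolding Iprod \<gamma>_def \<beta>_def w_def l_def L_def nth_Cons_Suc
    proof (rule prod_weight_powers)
      have "\<psi> * (1 - p) * (\<phi> * (1 - p)) = \<phi> * \<psi> * (1 - p)\<^sup>2"
        by (simp add: power2_eq_square)
      then show "\<psi> * (1 - p) * (\<phi> * (1 - p)) = (1 - p)\<^sup>2" by (simp add: phi(2))
    qed (use lpos in \<open>simp add: l_def\<close>)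
    have "M\<^sup>2 * (x ^ k * (\<Prod>j\<in>I. \<gamma> j ^ L j) * (\<Prod>j\<in>I. \<beta> j ^ L j))
        = ((x powr (- (real k / 2)))\<^sup>2 * x ^ k) * (((1 - p) powr (- real l))\<^sup>2
          * ((\<Prod>j\<in>I. \<gamma> j ^ L j) * (\<Prod>j\<in>I. \<beta> j ^ L j) * (Theta ls)\<^sup>2))"
      unfolding M by (simp only: power_mult_distrib mult_ac)
    then show ?thesis by (simp only: X W P mult_1)
  qed
  \<comment> \<open>The pair induction needs only exponents \<open>L j - 1\<close>. The saved
    factors, jointly at most \<open>1 - p\<close>, offset the factor \<open>1 - p\<close> in the
    initial excess.\<close>
  have GL: "(\<Prod>j\<in>I. \<gamma> j ^ L j) \<le> (1 - p) * (\<Prod>j\<in>I. \<gamma> j ^ (L j - 1))"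
  proof -
    obtain j0 where j0: "j0 \<in> I" using I by blast
    have "(\<Prod>j\<in>I. \<gamma> j) = \<gamma> j0 * (\<Prod>j\<in>I - {j0}. \<gamma> j)" using I j0 by (simp add: prod.remove)
    also have "\<dots> \<le> (1 - p) * 1"
      using g1 gpos j0 p by (intro mult_mono prod_le_1 prod_nonneg) (auto simp: less_imp_le intro: order_trans[OF g1])
    finally have le: "(\<Prod>j\<in>I. \<gamma> j) \<le> 1 - p" by simp
    have "(\<Prod>j\<in>I. \<gamma> j ^ L j) = (\<Prod>j\<in>I. \<gamma> j * \<gamma> j ^ (L j - 1))"
      using Lpos by (intro prod.cong) (auto simp flip: power_Suc)
    also have "\<dots> = (\<Prod>j\<in>I. \<gamma> j) * (\<Prod>j\<in>I. \<gamma> j ^ (L j - 1))" by (simp add: prod.distrib)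
    also have "\<dots> \<le> (1 - p) * (\<Prod>j\<in>I. \<gamma> j ^ (L j - 1))"
      using le gpos by (intro mult_right_mono prod_nonneg) (auto simp: less_imp_le)
    finally show ?thesis .
  qed
  have kl: "real k + real l \<ge> 2" using k lpos by simp
  have Mkl: "4 * (real k + real l) * M \<ge> 8 * M" using kl M1 by (intro mult_right_mono) auto
  have "real (card (nbr col 0 v V)) - p * n \<ge> (1 - p) * (4 * M - 1)" if v: "v \<in> V" for v
  proof -
    have "(\<Sum>j\<in>insert 0 I. real (card (nbr col j v V))) = real (card (V - {v}))"
      using sum_nbr[of "insert 0 I" V v col "\<lambda>_. 1"] I V v cols by simp
    also have "\<dots> = n - 1"
      using card.remove[OF V v] by (simp add: n_def)
    finally have "real (card (nbr col 0 v V)) \<ge> n - (1 - p) * (4 * (real k + real l - 1) * M)"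
      using deg[OF v] I by (simp add: Isum)
    then have "real (card (nbr col 0 v V)) - p * n \<ge> (1 - p) * (n - 4 * (real k + real l - 1) * M)"
      by (simp add: algebra_simps)
    moreover have "(1 - p) * (4 * M - 1) \<le> (1 - p) * (n - 4 * (real k + real l - 1) * M)"
      using card_V p by (intro mult_left_mono) (auto simp: n_def algebra_simps)
    ultimately show ?thesis by linarith
  qed
  then have "excess col 0 p V V \<ge> n * ((1 - p) * (4 * M - 1))"
    unfolding excess_def n_def by (intro sum_bounded_below) auto
  \<comment> \<open>The slack \<open>(1 - p) * n\<close> cancels the \<open>- 1\<close> in the
    surplus \<open>4 * M - 1\<close> of each vertex.\<close>
  then have "excess col 0 p V V + (1 - p) * n \<ge> (1 - p) * (4 * M * n)"
    by (simp add: algebra_simps)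
  moreover have "(1 - p) * (4 * M * n) \<ge> (1 - p) * M\<^sup>2"
  proof -
    have "M \<le> 4 * n" using card_V Mkl M1 unfolding n_def by linarith
    then show ?thesis using p M1 by (auto simp: power2_eq_square)
  qed
  ultimately have E: "excess col 0 p V V + (1 - p) * n \<ge> (1 - p) * M\<^sup>2" by linarith
  let ?G = "\<Prod>j\<in>I. \<gamma> j ^ (L j - 1)" and ?B = "\<Prod>j\<in>I. \<beta> j ^ L j"
  have "?B > 0" using gpos by (intro prod_pos) auto
  have "?G > 0" using gpos by (intro prod_pos) auto
  have "M\<^sup>2 * (x ^ k * (\<Prod>j\<in>I. \<gamma> j ^ L j) * ?B) \<le> M\<^sup>2 * (x ^ k * ((1 - p) * ?G) * ?B)"
    using GL x(2) \<open>?B > 0\<close> by (intro mult_left_mono mult_right_mono) auto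
  then have "1 \<le> M\<^sup>2 * (x ^ k * ((1 - p) * ?G) * ?B)" by (simp only: M2)
  also have "\<dots> = (1 - p) * M\<^sup>2 * (x ^ k * ?G * ?B)" by (simp only: mult_ac)
  also have "\<dots> \<le> (excess col 0 p V V + (1 - p) * n) * (x ^ k * ?G * ?B)"
    using E x \<open>?B > 0\<close> \<open>?G > 0\<close> by (intro mult_right_mono) auto
  finally have big: "1 \<le> (excess col 0 p V V + (1 - p) * n) * (x ^ k * ?G * ?B)" .
  have "monochromatic (V \<union> V) k 2 col 0
      \<or> (\<exists>i\<in>I. monochromatic V (Suc (L i - 1)) 2 col i \<or> monochromatic V (L i) 2 col i)"
    using big V cols I p x gpos gsum bsum
    by (intro bipartite_clique_induction[where \<gamma> = \<gamma> and \<beta> = \<beta> and p = p and x = x])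
      (auto simp: n_def)
  then have "monochromatic V (L 0) 2 col 0 \<or> (\<exists>i\<in>I. monochromatic V (L i) 2 col i)"
    using Lpos by (auto simp: L_def)
  then show ?thesis by (auto simp: L_def I_def less_Suc_eq_le)
qed

section \<open>Induction on the sum of the blue clique sizes\<close>

theorem theorem5p3:
  fixes p :: real and k :: nat and ls :: "nat list"
  assumes "(sqrt 5 - 1) / (sqrt 5 + 1) < p" and "p < 1"
  shows "real (multicolor_ramsey k ls)
    \<le> 4 * (real k + real (sum_list ls))
        * ((1 + sqrt 5) / 2 * p + (1 - sqrt 5) / 2) powr (- (real k / 2))
        * (1 - p) powr (- real (sum_list ls))
        * Theta ls"
proof (induction "sum_list ls" arbitrary: ls rule: less_induct)
  case less
  define x where "x = (1 + sqrt 5) / 2 * p + (1 - sqrt 5) / 2"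
  define l where "l = sum_list ls"
  define M where "M = x powr (- (real k / 2)) * (1 - p) powr (- real l) * Theta ls"
  have s5: "sqrt 5 > 1" by simp
  have "0 < (sqrt 5 - 1) / (sqrt 5 + 1)" using s5 by (intro divide_pos_pos) linarith+
  then have p: "0 < p" using assms(1) by linarith
  have x: "0 < x" "x < 1"
  proof -
    \<comment> \<open>The assumed lower bound on \<open>p\<close> says precisely that
      \<open>x\<close> is positive.\<close>
    have "sqrt 5 - 1 < p * (sqrt 5 + 1)"
      using assms(1) s5 pos_divide_less_eq[of "sqrt 5 + 1" "sqrt 5 - 1" p] by linarith
    then show "0 < x" by (simp add: x_def field_simps)
    have "(1 + sqrt 5) / 2 * p < (1 + sqrt 5) / 2 * 1"
      using s5 assms(2) by (intro mult_strict_left_mono divide_pos_pos) linarith+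
    then show "x < 1" by (simp add: x_def field_simps)
  qed
  have M0: "M \<ge> 0" using Theta_nonneg by (simp add: M_def)
  have "real (multicolor_ramsey k ls) \<le> 4 * (real k + real l) * M"
  \<comment> \<open>A required clique of size 0 makes the Ramsey number 0; with no blue colours it
    is at most \<open>k\<close>.\<close>
  proof (cases "k = 0 \<or> ls = [] \<or> 0 \<in> set ls")
    case True
    then consider "k = 0 \<or> 0 \<in> set ls" | "ls = []" by blast
    then show ?thesis
    proof cases
      case 1
      then obtain j where "j < Suc (length ls)" "(k # ls) ! j = 0"
        by (metis in_set_conv_nth length_Cons list.set_intros)
      then have "partn_lst {..<0} (k # ls) 2"
        unfolding partn_lst_def by (metis length_Cons monochromatic_0)
      then have "multicolor_ramsey k ls \<le> 0" by (rule multicolor_ramsey_le)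
      then show ?thesis using M0 by simp
    next
      case 2
      have "partn_lst {..<k} [k] 2"
        by (auto simp: partn_lst_def monochromatic_def Pi_iff)
      then have "real (multicolor_ramsey k ls) \<le> real k"
        using 2 multicolor_ramsey_le by (simp add: multicolor_ramsey_le)
      moreover have "M \<ge> 1"
        using 2 x p assms(2) by (simp add: M_def l_def Theta_def powr_minus one_le_inverse_iff powr_le1)
      then have "real k * 1 \<le> (4 * real k) * M" by (intro mult_mono) auto
      ultimately show ?thesis using 2 by (simp add: l_def)
    qed
  next
    case False
    then have k: "k > 0" and ls: "ls \<noteq> []" "0 \<notin> set ls" by auto
    have ipos: "ls ! i > 0" if "i < length ls" for i
      using that ls(2) nth_mem[of i ls] by (metis gr0I)
    have lpos: "l > 0"
      using ipos[of 0] ls member_le_sum_list[of "ls ! 0" ls] by (auto simp: l_def)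
    \<comment> \<open>Rounding down loses less than 1, the loss allowed by the hypothesis on
      \<open>card V\<close> in the previous lemma.\<close>
    define n where "n = nat \<lfloor>4 * (real k + real l) * M\<rfloor>"
    have n: "real n \<le> 4 * (real k + real l) * M" "4 * (real k + real l) * M - 1 \<le> real n"
      using M0 by (auto simp: n_def)
    have "partn_lst {..<n} (k # ls) 2"
    proof (rule ccontr)
      assume "\<not> ?thesis"
      then obtain col where col: "col \<in> nsets {..<n} 2 \<rightarrow> {..<Suc (length ls)}"
        and no: "\<And>j. j < Suc (length ls) \<Longrightarrow> \<not> monochromatic {..<n} ((k # ls) ! j) 2 col j"
        by (auto simp: partn_lst_def)
      have deg: "(\<Sum>i<length ls. real (card (nbr col (Suc i) v {..<n}))) + 1
          \<le> (1 - p) * (4 * (real k + real l - 1) * M)" if v: "v \<in> {..<n}" for v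
      proof -
        \<comment> \<open>This is the bound for a list of sum \<open>l - 1\<close> without its
          \<open>Theta\<close> factor. The exponent \<open>1 - real l\<close> supplies the factor
          \<open>1 - p\<close> in the degree bound.\<close>
        define c where "c = 4 * (real k + real l - 1) * x powr (- (real k / 2)) * (1 - p) powr (1 - real l)"
        have c: "c \<ge> 0" using k by (simp add: c_def)
        have each: "real (card (nbr col (Suc i) v {..<n})) + 1 \<le> c * Theta ls * (real (ls ! i) / real l)"
          if i: "i < length ls" for i
        proof -
          let ?ls = "ls[i := ls ! i - 1]"
          have "ls ! i \<le> l" using i by (auto simp: l_def intro: member_le_sum_list)
          then have s: "sum_list ?ls = l - 1"
            using i ipos[OF i] by (simp add: sum_list_update l_def)
          have "card (nbr col (Suc i) v {..<n}) < multicolor_ramsey k ?ls"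
            using col no i v by (intro card_nbr_less_multicolor_ramsey) auto
          then have "real (card (nbr col (Suc i) v {..<n})) + 1 \<le> real (multicolor_ramsey k ?ls)"
            by linarith
          also have "\<dots> \<le> c * Theta ?ls"
            using less[of ?ls] s lpos by (simp add: c_def x_def l_def of_nat_diff Suc_le_eq algebra_simps)
          also have "\<dots> \<le> c * (real (ls ! i) / real l * Theta ls)"
            using c Theta_decrement[OF i ipos[OF i]] by (intro mult_left_mono) (auto simp: l_def)
          finally show ?thesis by (simp add: mult_ac)
        qed
        \<comment> \<open>Strictness of the degree bounds yields \<open>+ 1\<close> for each blue
          colour; one of them is kept, to account for \<open>v\<close> itself.\<close>
        have "(\<Sum>i<length ls. real (card (nbr col (Suc i) v {..<n}))) + 1
            \<le> (\<Sum>i<length ls. real (card (nbr col (Suc i) v {..<n})) + 1)"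
          using ls by (simp add: sum.distrib Suc_le_eq)
        also have "\<dots> \<le> (\<Sum>i<length ls. c * Theta ls * (real (ls ! i) / real l))"
          using each by (intro sum_mono) auto
        also have "\<dots> = c * Theta ls * ((\<Sum>i<length ls. real (ls ! i)) / real l)"
          by (simp add: sum_distrib_left sum_divide_distrib)
        also have "(\<Sum>i<length ls. real (ls ! i)) = real l"
          by (simp add: l_def sum_list_sum_nth atLeast0LessThan)
        also have "c * Theta ls * (real l / real l) = (1 - p) * (4 * (real k + real l - 1) * M)"
          using lpos assms(2) by (simp add: c_def M_def powr_diff powr_minus field_simps)
        finally show ?thesis .
      qed
      have "\<exists>j<Suc (length ls). monochromatic {..<n} ((k # ls) ! j) 2 col j"
        using p assms(2) x x_def k ls col n deg M_def
        by (intro monochromatic_if_blue_degrees_small[where p = p and x = x and M = M])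
          (auto simp: l_def)
      then show False using no by blast
    qed
    then have "multicolor_ramsey k ls \<le> n" by (rule multicolor_ramsey_le)
    then show ?thesis using n by linarith
  qed
  then show ?case by (simp add: M_def x_def l_def mult.assoc)
qed

end
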